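(* For every integer $n\geq 4$, the identity element $e$ is the only dominant vertex of $\Delta^o(A_n)$; that is, the set of dominant vertices of $\Delta^o(A_n)$ is $\{e\}$.
   Context: $A_n$ is the alternating group of degree $n$. For a finite group $G$, $o(g)$ denotes the order of $g\in G$, and the order super commuting graph $\Delta^o(G)$ is the simple undirected graph with vertex set $G$ in which two distinct elements $g,h$ are adjacent iff either $o(g)=o(h)$, or there exist $g',h'\in G$ with $o(g')=o(g)$, $o(h')=o(h)$ such that $g'$ and $h'$ are distinct and commute. A vertex is dominant if it is adjacent to every other vertex. *)

theory Defs
  imports "HOL-Algebra.Sym_Groups" "HOL-Algebra.Multiplicative_Group"
    "Graph_Theory.Pair_Digraph"
begin

text \<open>
  Simple undirected graphs are loop-free symmetric digraphs without parallel arcs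
  (locale \<^locale>\<open>pair_graph\<close>); an undirected edge is represented by both of its orientations.
\<close>

definition order_super_commuting_graph :: "('a, 'b) monoid_scheme \<Rightarrow> 'a pair_pre_digraph" where
  "order_super_commuting_graph G =
     \<lparr> pverts = carrier G,
       parcs = {(g, h). g \<in> carrier G \<and> h \<in> carrier G \<and> g \<noteq> h \<and>
         (group.ord G g = group.ord G h \<or>
          (\<exists>g' \<in> carrier G. \<exists>h' \<in> carrier G.
             group.ord G g' = group.ord G g \<and> group.ord G h' = group.ord G h \<and>
             g' \<noteq> h' \<and> g' \<otimes>\<^bsub>G\<^esub> h' = h' \<otimes>\<^bsub>G\<^esub> g'))} \<rparr>"

definition dominant_vertices :: "('a, 'b) pre_digraph \<Rightarrow> 'a set" where
  "dominant_vertices H = {v \<in> verts H. \<forall>w \<in> verts H. w \<noteq> v \<longrightarrow> v \<rightarrow>\<^bsub>H\<^esub> w}"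

lemma pair_graph_order_super_commuting_graph:
  assumes "finite (carrier G)"
  shows "pair_graph (order_super_commuting_graph G)"
proof
  let ?D = "order_super_commuting_graph G"
  have sub: "parcs ?D \<subseteq> carrier G \<times> carrier G"
    by (auto simp: order_super_commuting_graph_def)
  show "finite (pverts ?D)"
    using assms by (simp add: order_super_commuting_graph_def)
  show "finite (parcs ?D)"
    using finite_subset[OF sub] assms by simp
  show "fst e \<in> pverts ?D" "snd e \<in> pverts ?D" "fst e \<noteq> snd e" if "e \<in> parcs ?D" for e
    using that by (auto simp: order_super_commuting_graph_def)
  show "symmetric (with_proj ?D)"
    unfolding symmetric_def with_proj_simps
    by (rule symI, simp add: order_super_commuting_graph_def) metis
qed

end

theory Submission
  imports Defs "HOL-Computational_Algebra.Primes" "HOL-Library.Discrete_Functions"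
begin

text \<open>
  If g and h commute, p is a prime divisor of the order of g, and p is coprime to the order k of h,
  then a power of g times h has order pk. So a nontrivial v with p dividing its order is not dominant
  as soon as the alternating group has an element of order k coprime to p but no element of order
  divisible by pk.

  An even permutation of degree n whose order is divisible by an even prime power e and by the odd
  primes in Q forces n to be at least e + 2 + (sum of Q), the extra 2 being due to a second cycle of
  even length. By Bertrand's postulate, a greedy choice gives distinct primes greater than p whose
  sum P misses a given N by at most 2p - 2. For p = 2 take N = n and let k be the product of these
  primes. For odd p take N = n - 4 and cycles of length 2^a and 2 in addition, with a as large as
  possible; then fewer than p points are left over.
\<close>

section \<open>Divisibility\<close>

text \<open>The multiplicity of a prime in an lcm is the maximum of its multiplicities in the two
  numbers.\<close>

lemma prime_power_dvd_lcm:
  fixes p :: nat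
  assumes "prime p" and "p ^ k dvd lcm x y"
  shows "p ^ k dvd x \<or> p ^ k dvd y"
proof (cases "x = 0 \<or> y = 0")
  case False
  moreover have "\<not> is_unit p"
    using assms(1) not_prime_unit by blast
  ultimately show ?thesis
    using assms
    by (simp add: power_dvd_iff_le_multiplicity multiplicity_lcm lcm_eq_0_iff le_max_iff_disj)
qed auto

lemma prime_power_dvd_Lcm:
  fixes p :: nat
  assumes "finite A" and "prime p" and "k > 0" and "p ^ k dvd Lcm A"
  shows "\<exists>a\<in>A. p ^ k dvd a"
  using assms(1,4)
proof (induction A rule: finite_induct)
  case empty
  then have "p ^ k = 1"
    by simp
  then show ?case
    using assms(2,3) by (auto simp: prime_gt_1_nat)
next
  case (insert x A)
  then show ?case
    using prime_power_dvd_lcm[OF assms(2), of k x "Lcm A"] by auto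
qed

lemma prod_coprime_dvd:
  fixes m :: nat
  assumes "finite P" and "pairwise coprime P" and "\<And>p. p \<in> P \<Longrightarrow> p dvd m"
  shows "\<Prod>P dvd m"
  using assms
proof (induction P rule: finite_induct)
  case (insert p P)
  have "coprime p (\<Prod>P)"
    using insert.prems(1) insert.hyps(2) by (auto simp: pairwise_insert intro!: prod_coprime_right)
  then show ?case
    using insert by (simp add: divides_mult pairwise_insert)
qed simp

section \<open>Bertrand's postulate\<close>

text \<open>
  With L(n, k) = k (n choose k), the Leibniz harmonic triangle satisfies
  1/L(n, k+1) = 1/L(n-1, k) - 1/L(n, k), so D/L(n, k+1) is an integer if the other two are.
\<close>

lemma mult_binomial_dvd:
  fixes D :: nat
  assumes "\<And>i. 1 \<le> i \<Longrightarrow> i \<le> n \<Longrightarrow> i dvd D" and "1 \<le> k" and "k \<le> n"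
  shows "k * (n choose k) dvd D"
  using assms(2,3,1)
proof (induction k arbitrary: n rule: nat_induct_at_least)
  case base
  then show ?case by simp
next
  case (Suc k)
  then obtain m where n: "n = Suc m" and km: "k \<le> m"
    by (cases n) auto
  define X where "X = m choose k"
  \<comment> \<open>In the notation L(n, k) these are a = L(m, k), b = L(n, k) and c = L(n, k+1),
    the last by absorption.\<close>
  define a b c where "a = k * X" and "b = k * (Suc m choose k)" and "c = Suc m * X"
  have c: "Suc k * (n choose Suc k) = c"
    unfolding c_def X_def n by (rule Suc_times_binomial)
  have pos: "a > 0" "b > 0"
    using Suc.hyps km by (auto simp: a_def b_def X_def zero_less_binomial_iff)
  have "a dvd D" unfolding a_def X_def
    using Suc.IH[of m] Suc.prems km n by auto
  then obtain u where u: "D = a * u" ..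
  have "b dvd D" unfolding b_def
    using Suc.IH[of n] Suc.prems km n by auto
  then obtain v where v: "D = b * v" ..
  have "(Suc m - k) * (Suc m choose k) = Suc m * X"
    using binomial_absorb_comp[of "Suc m" k] by (simp add: X_def)
  then have "int (Suc m - k) * int b = int k * int c"
    unfolding b_def c_def by (metis mult.left_commute of_nat_mult)
  then have "(int m + 1 - int k) * int b = int k * int c"
    using km by (simp add: of_nat_diff add.commute)
  moreover have "int c * int b - int c * int a - int a * int b
      = int X * ((int m + 1 - int k) * int b - int k * int c)"
    by (simp add: a_def c_def algebra_simps)
  \<comment> \<open>This is 1/c = 1/a - 1/b with the denominators cleared, over the integers to
    avoid truncated subtraction. With D/a = u and D/b = v it gives D/c = u - v.\<close>
  ultimately have ab: "int c * int b - int c * int a = int a * int b"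
    by simp
  have "int a * int b * (int c * (int u - int v))
      = int c * int b * (int a * int u) - int c * int a * (int b * int v)"
    by (simp add: algebra_simps)
  also have "\<dots> = (int c * int b - int c * int a) * int D"
    using arg_cong[OF u, of int] arg_cong[OF v, of int] by (simp add: left_diff_distrib)
  finally have "int a * int b * (int c * (int u - int v)) = int a * int b * int D"
    unfolding ab .
  then have "int D = int c * (int u - int v)"
    using pos by simp
  then have "int c dvd int D" ..
  then show ?case
    unfolding c by simp
qed

text \<open>The binomial coefficient divides \<open>Lcm {1..n}\<close>, and a prime power dividing
  this lcm divides one of the numbers up to n.\<close>

lemma prime_power_dvd_binomial_le:
  fixes p :: nat
  assumes "prime p" and "j > 0" and "1 \<le> k" and "k \<le> n" and "p ^ j dvd (n choose k)"
  shows "p ^ j \<le> n"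
proof -
  have "k * (n choose k) dvd Lcm {1..n}"
    by (rule mult_binomial_dvd) (use assms in auto)
  then have "p ^ j dvd Lcm {1..n}"
    using assms(5) by (meson dvd_mult dvd_trans)
  then obtain i where "i \<in> {1..n}" "p ^ j dvd i"
    using prime_power_dvd_Lcm[of "{1..n}" p j] assms by auto
  then show ?thesis
    by (metis atLeastAtMost_iff dvd_imp_le le_trans less_le_trans zero_less_one)
qed

text \<open>Erdos's induction: an even n > 2 adds no prime. For n = 2m + 1 the primes in (m + 1, n]
  all divide \<open>n choose m\<close>, which is at most 4^m; the induction hypothesis for m + 1
  covers the others.\<close>

lemma primorial_le: "\<Prod>{p::nat. prime p \<and> p \<le> n} \<le> 4 ^ n"
proof (induction n rule: less_induct)
  case (less n)
  let ?P = "\<lambda>n. {p::nat. prime p \<and> p \<le> n}"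
  have fin: "finite (?P k)" for k
    by (rule finite_subset[of _ "{..k}"]) auto
  consider "n \<le> 1" | "n = 2" | "n > 2" "even n" | "n > 2" "odd n"
    by linarith
  then show ?case
  proof cases
    case 1
    then have "?P n = {}"
      by (auto dest!: prime_ge_2_nat)
    then show ?thesis by (simp only: prod.empty) simp
  next
    case 2
    then have "?P n = {2}"
      using prime_ge_2_nat by (auto intro: antisym)
    then show ?thesis using 2 by simp
  next
    case 3
    then have "\<not> prime n"
      using prime_odd_nat by blast
    moreover have "p \<le> n - 1" if "p \<le> n" "p \<noteq> n" for p
      using that by simp
    ultimately have "?P n = ?P (n - 1)"
      by auto
    moreover have "\<Prod>(?P (n - 1)) \<le> 4 ^ (n - 1)"
      using less 3 by simp
    moreover have "(4::nat) ^ (n - 1) \<le> 4 ^ n"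
      by (simp add: power_increasing)
    ultimately show ?thesis
      by (metis le_trans)
  next
    case 4
    then obtain m where m: "n = 2 * m + 1" "m \<ge> 1"
      by (auto elim!: oddE)
    define Q where "Q = {p::nat. prime p \<and> m + 1 < p \<and> p \<le> n}"
    have finQ: "finite Q"
      by (rule finite_subset[OF _ fin[of n]]) (auto simp: Q_def)
    have "p dvd (n choose m)" if "p \<in> Q" for p
    proof -
      have p: "prime p" "m + 1 < p" "p \<le> n"
        using that by (auto simp: Q_def)
      have "fact m * fact (m + 1) * (n choose m) = (fact n :: nat)"
        using binomial_fact_lemma[of m n] m by simp
      moreover have "p dvd fact n" "\<not> p dvd fact m" "\<not> p dvd fact (m + 1)"
        using p by (auto simp only: prime_dvd_fact_iff)
      ultimately show ?thesis
        using p(1) by (metis prime_dvd_mult_iff)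
    qed
    then have "\<Prod>Q dvd (n choose m)"
      using finQ by (intro prod_coprime_dvd) (auto simp: Q_def pairwise_def primes_coprime)
    then have "\<Prod>Q \<le> (n choose m)"
      using m by (intro dvd_imp_le) (auto simp: zero_less_binomial_iff)
    also have "\<dots> \<le> 4 ^ m"
    proof -
      \<comment> \<open>Two equal entries of a row with sum 2^(2m+1), so each is at most half of
        that sum.\<close>
      have "n choose (m + 1) = n choose m"
        using binomial_symmetric[of m n] m by simp
      then have "2 * (n choose m) = (\<Sum>k\<in>{m, m + 1}. n choose k)"
        by simp
      also have "\<dots> \<le> (\<Sum>k\<le>n. n choose k)"
        by (rule sum_mono2) (use m in auto)
      also have "\<dots> = 2 * 4 ^ m"
        unfolding choose_row_sum using m by (simp add: power_mult)
      finally show ?thesis by simp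
    qed
    finally have Q: "\<Prod>Q \<le> 4 ^ m" .
    have "?P n = ?P (m + 1) \<union> Q" "?P (m + 1) \<inter> Q = {}"
      using m by (auto simp: Q_def)
    then have "\<Prod>(?P n) = \<Prod>(?P (m + 1)) * \<Prod>Q"
      using prod.union_disjoint[OF fin finQ, of "m + 1" "\<lambda>p. p"] by simp
    also have "\<dots> \<le> 4 ^ (m + 1) * 4 ^ m"
      using less[of "m + 1"] m Q by (intro mult_mono) auto
    also have "\<dots> = 4 ^ n"
      using m by (simp add: mult_2 power_add)
    finally show ?thesis .
  qed
qed

section \<open>Prime factors of the central binomial coefficient\<close>

text \<open>If p divided the coefficient, p^3 would divide (2n)!, since p also divides n! twice
  over. But only p and 2p are multiples of p up to 2n, and for odd p they supply just p^2.\<close>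

lemma not_prime_dvd_central_binomial:
  fixes p :: nat
  assumes "prime p" and "p > 2" and "p \<le> n" and "2 * n < 3 * p"
  shows "\<not> p dvd (2 * n choose n)"
proof
  assume "p dvd (2 * n choose n)"
  moreover have "p dvd fact n"
    using assms by (simp add: prime_dvd_fact_iff)
  moreover have "fact n * fact n * (2 * n choose n) = (fact (2 * n) :: nat)"
    using binomial_fact_lemma[of n "2 * n"] by simp
  ultimately have "p * p * p dvd fact (2 * n)"
    by (metis mult_dvd_mono)
  also have "fact (2 * n) = \<Prod>{1..2 * n}"
    by (simp add: fact_prod)
  also have "\<dots> = p * (2 * p * \<Prod>({1..2 * n} - {p} - {2 * p}))"
    using assms prod.remove[of "{1..2 * n}" p "\<lambda>x. x"]
      prod.remove[of "{1..2 * n} - {p}" "2 * p" "\<lambda>x. x"] by auto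
  finally have "p dvd 2 * \<Prod>({1..2 * n} - {p} - {2 * p})"
    using assms(2) by (simp add: mult.assoc)
  moreover have "\<not> p dvd 2"
    using assms(2) by (auto dest: dvd_imp_le)
  ultimately have "p dvd (\<Prod>i\<in>{1..2 * n} - {p} - {2 * p}. i)"
    using assms(1) by (simp add: prime_dvd_mult_iff)
  then obtain i where i: "i \<in> {1..2 * n} - {p} - {2 * p}" "p dvd i"
    using assms(1) prime_dvd_prod_iff[of "{1..2 * n} - {p} - {2 * p}" p "\<lambda>i. i"] by blast
  obtain k where k: "i = p * k"
    using i(2) by (rule dvdE)
  have "k \<noteq> 0" "k \<noteq> 1" "k \<noteq> 2"
    using i k by auto
  then have "p * 3 \<le> p * k"
    by (intro mult_le_mono2) simp
  then have "3 * p \<le> i"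
    unfolding k by linarith
  then show False
    using i(1) assms(4) by simp
qed


text \<open>Split the prime factorization at s. The at most s primes up to s contribute prime powers
  of at most 2n each. A prime above s occurs only once, as its square exceeds 2n, and all prime
  factors are at most 2n/3, so the rest is bounded by a primorial.\<close>

lemma prod_primes_central_binomial_le:
  fixes n s :: nat
  assumes n: "n \<ge> 3" and s: "2 * n < (s + 1)\<^sup>2"
    and no_prime: "\<And>p. prime p \<Longrightarrow> n < p \<Longrightarrow> \<not> p < 2 * n"
  shows "(2 * n choose n) \<le> (2 * n) ^ s * 4 ^ (2 * n div 3)"
proof -
  define C where "C = (2 * n choose n)"
  define F where "F = prime_factors C"
  have C0: "C \<noteq> 0"
    using zero_less_binomial_iff[of "2 * n" n] by (simp add: C_def)
  have finF: "finite F"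
    by (simp add: F_def)
  have pow_le: "p ^ multiplicity p C \<le> 2 * n" if "p \<in> F" for p
  proof (rule prime_power_dvd_binomial_le)
    show "prime p" "0 < multiplicity p C"
      using that by (auto simp: F_def prime_factors_multiplicity)
    show "1 \<le> n" "n \<le> 2 * n"
      using n by auto
    show "p ^ multiplicity p C dvd 2 * n choose n"
      unfolding C_def by (rule multiplicity_dvd)
  qed
  have F_le: "p \<le> 2 * n div 3" if p: "p \<in> F" for p
  proof -
    have pr: "prime p" and dvd: "p dvd C" and "multiplicity p C > 0"
      using p in_prime_factors_imp_dvd[of p C] by (auto simp: F_def prime_factors_multiplicity)
    then have "p ^ 1 \<le> p ^ multiplicity p C"
      by (intro power_increasing) (auto simp: prime_ge_Suc_0_nat)
    then have "p \<le> 2 * n"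
      using pow_le[OF p] by simp
    \<comment> \<open>The endpoint 2n is not covered by \<open>no_prime\<close>, but it is
      composite.\<close>
    moreover have "p \<noteq> 2 * n"
      using pr n by (auto dest: prime_product)
    ultimately have "p \<le> n"
      using no_prime[OF pr] by linarith
    \<comment> \<open>The prime 2 escapes the previous lemma; it is at most
      \<open>2 * n div 3\<close> because n \<ge> 3.\<close>
    have "\<not> 2 * n < 3 * p \<or> p \<le> 2"
      using not_prime_dvd_central_binomial[OF pr _ \<open>p \<le> n\<close>] dvd unfolding C_def by linarith
    then show ?thesis
      using n by linarith
  qed
  have small: "(\<Prod>p\<in>{p\<in>F. p \<le> s}. p ^ multiplicity p C) \<le> (2 * n) ^ s"
  proof -
    have "(\<Prod>p\<in>{p\<in>F. p \<le> s}. p ^ multiplicity p C) \<le> (2 * n) ^ card {p\<in>F. p \<le> s}"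
      using prod_le_power[of "{p\<in>F. p \<le> s}" "\<lambda>p. p ^ multiplicity p C" "2 * n"] pow_le n by auto
    also have "card {p\<in>F. p \<le> s} \<le> card {1..s}"
      by (intro card_mono) (auto simp: F_def in_prime_factors_iff prime_ge_Suc_0_nat)
    then have "(2 * n) ^ card {p\<in>F. p \<le> s} \<le> (2 * n) ^ s"
      using n by (intro power_increasing) auto
    finally show ?thesis .
  qed
  have large: "(\<Prod>p\<in>{p\<in>F. \<not> p \<le> s}. p ^ multiplicity p C) \<le> 4 ^ (2 * n div 3)"
  proof -
    have "multiplicity p C = 1" if "p \<in> F" "\<not> p \<le> s" for p
    proof (rule ccontr)
      assume "multiplicity p C \<noteq> 1"
      moreover have "prime p" "multiplicity p C > 0"
        using that by (auto simp: F_def prime_factors_multiplicity)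
      ultimately have "p ^ 2 \<le> p ^ multiplicity p C"
        by (intro power_increasing) (auto simp: prime_ge_Suc_0_nat)
      also have "\<dots> \<le> 2 * n"
        using pow_le that by blast
      also have "\<dots> < (s + 1)\<^sup>2"
        by (rule s)
      finally have "p < s + 1"
        using power_less_imp_less_base by blast
      then show False using that by simp
    qed
    then have "(\<Prod>p\<in>{p\<in>F. \<not> p \<le> s}. p ^ multiplicity p C) = \<Prod>{p\<in>F. \<not> p \<le> s}"
      by (intro prod.cong[OF refl]) simp
    also have "\<dots> \<le> \<Prod>{p. prime p \<and> p \<le> 2 * n div 3}"
    proof (rule dvd_imp_le)
      have "{p. prime p \<and> p \<le> 2 * n div 3} \<subseteq> {..2 * n div 3}"
        by auto
      then have "finite {p. prime p \<and> p \<le> 2 * n div 3}"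
        by (rule finite_subset) simp
      moreover have "{p \<in> F. \<not> p \<le> s} \<subseteq> {p. prime p \<and> p \<le> 2 * n div 3}"
        using F_le by (auto simp: F_def in_prime_factors_iff)
      ultimately show "\<Prod>{p \<in> F. \<not> p \<le> s} dvd \<Prod>{p. prime p \<and> p \<le> 2 * n div 3}"
        by (rule prod_dvd_prod_subset)
      show "0 < \<Prod>{p. prime p \<and> p \<le> 2 * n div 3}"
        by (intro prod_pos) (auto simp: prime_gt_0_nat)
    qed
    also have "\<dots> \<le> 4 ^ (2 * n div 3)"
      by (rule primorial_le)
    finally show ?thesis .
  qed
  have "C = (\<Prod>p\<in>F. p ^ multiplicity p C)"
    unfolding F_def using C0 by (intro prime_factorization_nat) simp
  also have "\<dots> = (\<Prod>p\<in>{p\<in>F. p \<le> s}. p ^ multiplicity p C) * (\<Prod>p\<in>{p\<in>F. \<not> p \<le> s}. p ^ multiplicity p C)"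
    using finF by (subst prod.union_disjoint[symmetric]) (auto intro!: arg_cong2[of _ _ _ _ prod])
  also have "\<dots> \<le> (2 * n) ^ s * 4 ^ (2 * n div 3)"
    using small large by (rule mult_mono) auto
  finally show ?thesis
    unfolding C_def .
qed

section \<open>Bertrand's postulate for large and small n\<close>

text \<open>At t = 32 both sides equal 2^30; each further step multiplies the left side by at most
  (33/32)^6 < 2.\<close>

lemma power6_le_power2:
  fixes t :: nat
  assumes "t \<ge> 32"
  shows "t ^ 6 \<le> 2 ^ (t - 2)"
  using assms
proof (induction t rule: nat_induct_at_least)
  case (Suc t)
  have "(32 * (t + 1)) ^ 6 \<le> (33 * t) ^ 6"
    using Suc.hyps by (intro power_mono) auto
  then have "32 ^ 6 * (t + 1) ^ 6 \<le> 33 ^ 6 * t ^ 6"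
    by (simp only: power_mult_distrib)
  then have "(t + 1) ^ 6 \<le> 2 * t ^ 6"
    by simp
  also have "\<dots> \<le> 2 * 2 ^ (t - 2)"
    using Suc.IH by simp
  also have "\<dots> = 2 ^ (Suc t - 2)"
    using Suc.hyps by (simp flip: power_Suc add: Suc_diff_le)
  finally show ?case by simp
qed simp

text \<open>Without such a prime, the upper bound on \<open>2 * n choose n\<close> contradicts the
  lower bound 4^n / (2n): with t about the square root of 2n, the two yield 4^n \<le> t^(6t), which
  is too small.\<close>

lemma bertrand_large:
  fixes n :: nat
  assumes n: "n \<ge> 512"
  shows "\<exists>p. prime p \<and> n < p \<and> p < 2 * n"
proof (rule ccontr)
  assume contra: "\<not> ?thesis"
  define s where "s = floor_sqrt (2 * n)"
  define t where "t = s + 1"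
  have s1: "s\<^sup>2 \<le> 2 * n" and s2: "2 * n < t\<^sup>2"
    using floor_sqrt_power2_le[of "2 * n"] Suc_floor_sqrt_power2_gt[of "2 * n"]
    by (auto simp: s_def t_def)
  \<comment> \<open>The threshold 512 is chosen so that 2n \<ge> 32^2, as
    \<open>power6_le_power2\<close> requires of t.\<close>
  have "32 ^ 2 < t\<^sup>2"
    using n s2 by simp
  then have t: "t \<ge> 32"
    using power_less_imp_less_base by (metis less_imp_le zero_le)
  have C: "(2 * n choose n) \<le> (2 * n) ^ s * 4 ^ (2 * n div 3)"
    using contra n s2 by (intro prod_primes_central_binomial_le) (auto simp: t_def)
  have "real (4 ^ n) \<le> real (2 * n * (2 * n choose n))"
    using central_binomial_lower_bound[of n] n by (simp add: field_simps)
  then have "4 ^ n \<le> 2 * n * (2 * n choose n)"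
    by (simp only: of_nat_le_iff)
  also have "\<dots> \<le> 2 * n * ((2 * n) ^ s * 4 ^ (2 * n div 3))"
    using C by (rule mult_left_mono) simp
  also have "\<dots> = (2 * n) ^ t * 4 ^ (2 * n div 3)"
    by (simp add: t_def)
  \<comment> \<open>Cubing removes the rounded exponent: 3 times \<open>2 * n div 3\<close> is at
    most 2n.\<close>
  finally have "(4 ^ n) ^ 3 \<le> ((2 * n) ^ t * 4 ^ (2 * n div 3)) ^ 3"
    by (rule power_mono) simp
  also have "\<dots> = (2 * n) ^ (3 * t) * 4 ^ (3 * (2 * n div 3))"
    by (simp add: power_mult_distrib mult.commute flip: power_mult)
  also have "\<dots> \<le> (2 * n) ^ (3 * t) * 4 ^ (2 * n)"
    by (intro mult_left_mono power_increasing) auto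
  finally have "4 ^ n * (4 ^ (2 * n)) \<le> (2 * n) ^ (3 * t) * (4::nat) ^ (2 * n)"
    by (simp flip: power_mult power_add add: mult.commute)
  then have "4 ^ n \<le> (2 * n) ^ (3 * t)"
    by simp
  also have "\<dots> \<le> (t\<^sup>2) ^ (3 * t)"
    using s2 by (intro power_mono) auto
  also have "\<dots> = (t ^ 6) ^ t"
    by (simp flip: power_mult)
  also have "\<dots> \<le> (2 ^ (t - 2)) ^ t"
    using power6_le_power2[OF t] by (rule power_mono) simp
  also have "\<dots> = 2 ^ ((t - 2) * t)"
    by (simp flip: power_mult)
  also have "\<dots> < 2 ^ (s\<^sup>2)"
  proof (rule power_strict_increasing)
    obtain u where "t = u + 2"
      using t by (metis add.commute le_Suc_ex le_trans numeral_le_iff semiring_norm(68,71))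
    \<comment> \<open>Since t = s + 1, the product is (s - 1)(s + 1) = s^2 - 1; this is where the
      strict inequality arises.\<close>
    then show "(t - 2) * t < s\<^sup>2"
      by (simp add: t_def power2_eq_square algebra_simps)
  qed simp
  also have "\<dots> \<le> 2 ^ (2 * n)"
    using s1 by (rule power_increasing) simp
  also have "\<dots> = 4 ^ n"
    by (simp add: power_mult)
  finally show False by simp
qed

text \<open>In a proper factorization of p < k^2 one factor is below k. The bounded list makes the
  condition checkable by evaluation for concrete p.\<close>

lemma prime_by_trial_division:
  fixes p :: nat
  assumes "p > 1" and "p < k * k" and no_dvd: "\<forall>d\<in>set [2..<k]. \<not> d dvd p"
  shows "prime p"
proof (rule ccontr)
  assume "\<not> prime p"
  then obtain a where "a dvd p" and a: "a \<noteq> 1" "a \<noteq> p"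
    using assms(1) by (auto simp: prime_nat_iff)
  then obtain b where ab: "p = a * b"
    by (elim dvdE)
  have "p \<noteq> 0"
    using assms(1) by simp
  then have "a \<noteq> 0" "b \<noteq> 0" "b \<noteq> 1"
    using a(2) ab by auto
  then have "2 \<le> a" "2 \<le> b"
    using a(1) by auto
  moreover have "a < k \<or> b < k"
    using assms(2) ab by (meson mult_le_mono not_less)
  moreover have "a dvd p" "b dvd p"
    using ab by auto
  ultimately show False
    using no_dvd by auto
qed

theorem bertrand:
  fixes n :: nat
  assumes "n \<ge> 2"
  shows "\<exists>p. prime p \<and> n < p \<and> p < 2 * n"
proof (cases "n \<ge> 512")
  case True
  then show ?thesis by (rule bertrand_large)
next
  case False
  let ?bertrand = "\<exists>p. prime p \<and> n < p \<and> p < 2 * n"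
  \<comment> \<open>Chain of primes, each less than twice its predecessor: if n is not below p, then
    q < 2p \<le> 2n is itself the required prime whenever n < q. The chain starts vacuously at 2 and
    ends at 631, beyond all remaining n.\<close>
  have step: "n < q \<longrightarrow> ?bertrand"
    if "n < p \<longrightarrow> ?bertrand" "q < 2 * p" "prime q" for p q
  proof (cases "n < p")
    case False
    then have "q < 2 * n"
      using that(2) by linarith
    then show ?thesis
      using that(3) by blast
  qed (use that(1) in blast)
  have "n < 2 \<longrightarrow> ?bertrand"
    using assms by simp
  then have "n < 3 \<longrightarrow> ?bertrand"
    by (rule step) (simp, rule prime_by_trial_division[of _ 2], simp_all)
  then have "n < 5 \<longrightarrow> ?bertrand"
    by (rule step) (simp, rule prime_by_trial_division[of _ 3], simp_all)
  then have "n < 7 \<longrightarrow> ?bertrand"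
    by (rule step) (simp, rule prime_by_trial_division[of _ 3], simp_all)
  then have "n < 13 \<longrightarrow> ?bertrand"
    by (rule step) (simp, rule prime_by_trial_division[of _ 4], simp_all)
  then have "n < 23 \<longrightarrow> ?bertrand"
    by (rule step) (simp, rule prime_by_trial_division[of _ 5], simp_all)
  then have "n < 43 \<longrightarrow> ?bertrand"
    by (rule step) (simp, rule prime_by_trial_division[of _ 7], simp_all)
  then have "n < 83 \<longrightarrow> ?bertrand"
    by (rule step) (simp, rule prime_by_trial_division[of _ 10], simp_all)
  then have "n < 163 \<longrightarrow> ?bertrand"
    by (rule step) (simp, rule prime_by_trial_division[of _ 13], simp_all)
  then have "n < 317 \<longrightarrow> ?bertrand"
    by (rule step) (simp, rule prime_by_trial_division[of _ 18], simp_all)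
  then have "n < 631 \<longrightarrow> ?bertrand"
    by (rule step) (simp, rule prime_by_trial_division[of _ 26], simp_all)
  then show ?thesis
    using False by simp
qed

section \<open>Sums of coprime divisors\<close>

text \<open>Take a prime from the upper half of N by Bertrand and recurse on the remainder until it
  is at most 2p - 2. The bound q \<le> N keeps the primes chosen later below the current
  one.\<close>

lemma sum_primes_greedy:
  fixes p N :: nat
  assumes "p \<ge> 2"
  shows "\<exists>P. finite P \<and> (\<forall>q\<in>P. prime q \<and> p < q \<and> q \<le> N) \<and> \<Sum>P \<le> N \<and> N + 2 \<le> \<Sum>P + 2 * p"
proof (induction N rule: less_induct)
  case (less N)
  show ?case
  proof (cases "N + 2 \<le> 2 * p")
    case True
    then show ?thesis by (intro exI[of _ "{}"]) simp
  next
    case False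
    \<comment> \<open>Half of N rounded up: m reaches p already at N = 2p - 1, and a prime below 2m
      is still at most N.\<close>
    define m where "m = (N + 1) div 2"
    have m: "p \<le> m" "2 * m \<le> N + 1" "N \<le> 2 * m"
      using False unfolding m_def by linarith+
    obtain q where q: "prime q" "m < q" "q < 2 * m"
      using bertrand[of m] m assms by auto
    then obtain P where P: "finite P" "\<forall>r\<in>P. prime r \<and> p < r \<and> r \<le> N - q"
        "\<Sum>P \<le> N - q" "N - q + 2 \<le> \<Sum>P + 2 * p"
      using less.IH[of "N - q"] m by auto
    \<comment> \<open>Members of P are at most N - q < m < q.\<close>
    moreover have "q \<notin> P"
      using P(2) q m by fastforce
    ultimately show ?thesis
      using q m by (intro exI[of _ "insert q P"]) auto
  qed
qed

lemma sum_le_prod: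
  fixes W :: "nat set"
  assumes "finite W" and "W \<noteq> {}" and "\<And>w. w \<in> W \<Longrightarrow> w \<ge> 2"
  shows "\<Sum>W \<le> \<Prod>W"
  using assms
proof (induction W rule: finite_ne_induct)
  case (insert w W)
  obtain v where "v \<in> W"
    using insert.hyps by auto
  then have "2 \<le> \<Sum>W"
    using insert.hyps(1) insert.prems by (metis insertCI le_trans member_le_sum zero_le)
  then have W: "2 \<le> \<Prod>W"
    using insert by (meson insertCI le_trans)
  have "w \<ge> 2"
    using insert.prems by simp
  then obtain x y where "w = x + 2" "\<Prod>W = y + 2"
    using W by (metis add.commute le_Suc_ex)
  then have "w + \<Prod>W \<le> w * \<Prod>W"
    by (simp add: algebra_simps)
  moreover have "\<Sum>W \<le> \<Prod>W"
    using insert by auto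
  ultimately show ?case
    using insert.hyps by simp
qed simp

text \<open>The product of pairwise coprime divisors of l divides l, and it dominates the sum
  because x + y \<le> xy for x, y \<ge> 2.\<close>

lemma sum_coprime_divisors_le:
  fixes l :: nat
  assumes "finite W" and "pairwise coprime W" and "\<And>w. w \<in> W \<Longrightarrow> w \<ge> 2"
    and "\<And>w. w \<in> W \<Longrightarrow> w dvd l" and "l > 0"
  shows "\<Sum>W \<le> l"
proof (cases "W = {}")
  case False
  have "\<Sum>W \<le> \<Prod>W"
    using assms False by (intro sum_le_prod)
  also have "\<dots> \<le> l"
    using assms by (intro dvd_imp_le prod_coprime_dvd)
  finally show ?thesis .
qed simp

lemma sum_list_ge_prime_power_divisors:
  fixes Ls :: "nat list"
  assumes pos: "0 \<notin> set Ls" and even: "even (length (filter even Ls))"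
    and a: "a > 0" "\<exists>l\<in>set Ls. 2 ^ a dvd l"
    and Q: "finite Q" "\<And>q. q \<in> Q \<Longrightarrow> prime q \<and> odd q" "\<And>q. q \<in> Q \<Longrightarrow> \<exists>l\<in>set Ls. q dvd l"
  shows "2 ^ a + 2 + \<Sum>Q \<le> sum_list Ls"
proof -
  \<comment> \<open>Some entry i0 is divisible by 2^a and, by parity, another entry i1 is even; each q is charged to
    one entry it divides, 2^a to i0 and an additional 2 to i1. The numbers charged to an entry
    are coprime divisors of it, so their sum is at most that entry.\<close>
  let ?I = "{..<length Ls}"
  obtain i0 where i0: "i0 \<in> ?I" "2 ^ a dvd Ls ! i0"
    using a(2) by (auto simp: in_set_conv_nth)
  have "2 dvd Ls ! i0"
    using i0(2) a(1) by (meson dvd_power dvd_trans)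
  then have "i0 \<in> {i. i < length Ls \<and> even (Ls ! i)}"
    using i0(1) by simp
  moreover have "even (card {i. i < length Ls \<and> even (Ls ! i)})"
    using even by (simp add: length_filter_conv_card)
  ultimately have "{i. i < length Ls \<and> even (Ls ! i)} \<noteq> {i0}"
    by (metis card_1_singleton_iff One_nat_def odd_one)
  then obtain i1 where i1: "i1 \<in> ?I" "even (Ls ! i1)" "i1 \<noteq> i0"
    using \<open>i0 \<in> {i. i < length Ls \<and> even (Ls ! i)}\<close> by auto
  have "\<exists>i. i \<in> ?I \<and> q dvd Ls ! i" if "q \<in> Q" for q
    using Q(3)[OF that] by (auto simp: in_set_conv_nth)
  then obtain f where f: "\<And>q. q \<in> Q \<Longrightarrow> f q \<in> ?I \<and> q dvd Ls ! f q"
    by metis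
  \<comment> \<open>The powers of 2 charged to entry i, kept as a set so that they can be united
    with the primes charged there.\<close>
  define t where "t i = (if i = i0 then {2 ^ a} else if i = i1 then {2 :: nat} else {})" for i
  have "\<Sum>(t i) + \<Sum>{q\<in>Q. f q = i} \<le> Ls ! i" if i: "i \<in> ?I" for i
  proof -
    have coprime: "coprime (2 ^ b) q" if "q \<in> Q" for b q
      using Q(2)[OF that] by simp
    have ge2: "q \<ge> 2" if "q \<in> Q" for q
      using Q(2)[OF that] prime_ge_2_nat by blast
    have pw: "pairwise coprime Q"
      using Q(2) by (auto simp: pairwise_def primes_coprime)
    have "(2::nat) ^ 1 \<le> 2 ^ a"
      using a(1) by (intro power_increasing) auto
    moreover have "t i \<inter> {q\<in>Q. f q = i} = {}"
      using coprime[of "2 ^ a" a] coprime[of 2 1] Q(2) a(1) by (force simp: t_def)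
    moreover have "pairwise coprime (t i \<union> {q\<in>Q. f q = i})"
      using coprime coprime[where b = 1] pairwise_subset[OF pw, of "{q\<in>Q. f q = i}"]
      by (auto simp: t_def pairwise_insert coprime_commute)
    moreover have "w dvd Ls ! i" if "w \<in> t i \<union> {q\<in>Q. f q = i}" for w
      using that f i0 i1 by (auto simp: t_def split: if_splits)
    moreover have "Ls ! i > 0"
      using pos i by (metis gr0I lessThan_iff nth_mem)
    ultimately show ?thesis
      using sum_coprime_divisors_le[of "t i \<union> {q\<in>Q. f q = i}" "Ls ! i"] Q(1) ge2
      by (auto simp: sum.union_disjoint t_def split: if_splits)
  qed
  then have "(\<Sum>i\<in>?I. \<Sum>(t i) + \<Sum>{q\<in>Q. f q = i}) \<le> (\<Sum>i\<in>?I. Ls ! i)"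
    by (rule sum_mono)
  moreover have "(\<Sum>i\<in>?I. Ls ! i) = sum_list Ls"
    by (simp add: sum_list_sum_nth lessThan_atLeast0)
  moreover have "(\<Sum>i\<in>?I. \<Sum>{q\<in>Q. f q = i}) = \<Sum>Q"
    using Q(1) f by (intro sum.group) auto
  moreover have "(\<Sum>i\<in>?I. \<Sum>(t i)) = 2 ^ a + 2"
  proof -
    have "(\<Sum>i\<in>?I. \<Sum>(t i)) = (\<Sum>i\<in>{i0, i1}. \<Sum>(t i))"
      using i0(1) i1(1) by (intro sum.mono_neutral_right) (auto simp: t_def)
    then show ?thesis
      using i1(3) by (simp add: t_def)
  qed
  ultimately show ?thesis
    by (simp add: sum.distrib)
qed

section \<open>Orders of even permutations\<close>

text \<open>The witness is yh, where y is the power of g that has order p.\<close>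

lemma (in group) exists_ord_dvd_of_commuting:
  assumes g: "g \<in> carrier G" "ord g > 0" and h: "h \<in> carrier G" and comm: "g \<otimes> h = h \<otimes> g"
    and p: "p dvd ord g" "coprime p (ord h)"
  shows "\<exists>z\<in>carrier G. p * ord h dvd ord z"
proof -
  obtain j where j: "ord g = p * j"
    using p(1) ..
  define y where "y = g [^] j"
  define z where "z = y \<otimes> h"
  have y: "y \<in> carrier G" and z: "z \<in> carrier G"
    using g h by (auto simp: y_def z_def)
  have "y \<otimes> h = h \<otimes> y"
    unfolding y_def using comm g h by (metis group_commutes_pow)
  then have z_pow: "z [^] e = y [^] e \<otimes> h [^] e" for e :: nat
    unfolding z_def using y h by (intro pow_mult_distrib)
  \<comment> \<open>Here pj divides je exactly if p divides e; cancelling j is allowed because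
    \<open>ord g\<close> is positive.\<close>
  have y_pow: "y [^] e = \<one> \<longleftrightarrow> p dvd e" for e :: nat
    using g j by (simp add: y_def nat_pow_pow pow_eq_id mult.commute)
  \<comment> \<open>The first exponent kills z and h, hence also y; the second kills z and y, hence
    also h. Coprimality then strips off the extra factor.\<close>
  have "z [^] (ord z * ord h) = \<one>" "z [^] (ord z * p) = \<one>"
    using z by (auto simp: pow_eq_id)
  moreover have "h [^] (ord z * ord h) = \<one>" "y [^] (ord z * p) = \<one>"
    using h by (auto simp: pow_eq_id y_pow)
  ultimately have "y [^] (ord z * ord h) = \<one>" "h [^] (ord z * p) = \<one>"
    using y h by (auto simp: z_pow)
  then have "p dvd ord z * ord h" "ord h dvd ord z * p"
    using h by (auto simp: y_pow pow_eq_id)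
  then have "p dvd ord z" "ord h dvd ord z"
    using p(2) by (auto simp: coprime_dvd_mult_left_iff coprime_commute)
  then show ?thesis
    using z p(2) by (auto intro: divides_mult)
qed

section \<open>Powers, signs and cycle types of permutations\<close>

lemma disjoint_permutes_funpow:
  assumes "f permutes A" and "g permutes B" and "A \<inter> B = {}"
  shows "((f \<circ> g) ^^ e) x = (if x \<in> A then (f ^^ e) x else (g ^^ e) x)"
proof (induction e)
  case (Suc e)
  have f: "(f ^^ e) x \<in> A \<longleftrightarrow> x \<in> A" and g: "(g ^^ e) x \<in> B \<longleftrightarrow> x \<in> B"
    using permutes_in_image[OF permutes_funpow[OF assms(1)]]
      permutes_in_image[OF permutes_funpow[OF assms(2)]] by auto
  show ?case
  proof (cases "x \<in> A")
    case True
    then have "(f ^^ e) x \<notin> B"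
      using f assms(3) by blast
    then show ?thesis
      using Suc True permutes_not_in[OF assms(2)] by simp
  next
    case False
    have "g ((g ^^ e) x) \<notin> A"
    proof (cases "x \<in> B")
      case True
      then show ?thesis
        using g permutes_in_image[OF assms(2)] assms(3) by auto
    next
      case B: False
      then have "(g ^^ Suc e) x = x"
        using permutes_not_in[OF permutes_funpow[OF assms(2)]] by metis
      then show ?thesis
        using False by simp
    qed
    then show ?thesis
      using Suc False permutes_not_in[OF assms(1)] by simp
  qed
qed simp

lemma disjoint_permutes_funpow_eq_id:
  assumes "f permutes A" and "g permutes B" and "A \<inter> B = {}"
  shows "(f \<circ> g) ^^ e = id \<longleftrightarrow> f ^^ e = id \<and> g ^^ e = id"
proof -
  have f: "(f ^^ e) x = x" if "x \<notin> A" for x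
    using that permutes_not_in[OF permutes_funpow[OF assms(1)]] by metis
  have g: "(g ^^ e) x = x" if "x \<in> A" for x
    using that assms(3) permutes_not_in[OF permutes_funpow[OF assms(2)]] by (metis disjoint_iff)
  have "((f \<circ> g) ^^ e) x = x \<longleftrightarrow> (f ^^ e) x = x \<and> (g ^^ e) x = x" for x
    using disjoint_permutes_funpow[OF assms, of e x] f[of x] g[of x] by (cases "x \<in> A") simp_all
  then show ?thesis
    unfolding fun_eq_iff id_apply by blast
qed

lemma cycle_of_list_funpow_eq_id:
  assumes "distinct cs" and "cs \<noteq> []"
  shows "cycle_of_list cs ^^ e = id \<longleftrightarrow> length cs dvd e"
proof
  assume "cycle_of_list cs ^^ e = id"
  \<comment> \<open>The e-th power of the cycle maps \<open>cs\<close> to its rotation by e places;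
    comparing first entries of a distinct list gives the divisibility.\<close>
  then have "rotate e cs = cs"
    using cyclic_rotation[OF assms(1), of e] by simp
  then have "cs ! (e mod length cs) = cs ! 0"
    using assms(2) by (metis hd_conv_nth hd_rotate_conv_nth)
  then show "length cs dvd e"
    using assms by (auto simp: nth_eq_iff_index_eq)
next
  assume "length cs dvd e"
  then obtain k where "e = length cs * k" ..
  then show "cycle_of_list cs ^^ e = id"
    using cycle_is_id_root[OF assms(1)] by (simp flip: funpow_mult)
qed

text \<open>A cycle of length l is a product of l - 1 transpositions, one per recursive
  call.\<close>

lemma evenperm_cycle_of_list:
  assumes "distinct cs" and "cs \<noteq> []"
  shows "evenperm (cycle_of_list cs) \<longleftrightarrow> odd (length cs)"
  using assms
proof (induction cs rule: cycle_of_list.induct)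
  case (1 i j cs)
  have "evenperm (cycle_of_list (i # j # cs)) \<longleftrightarrow> \<not> evenperm (cycle_of_list (j # cs))"
    using 1 by (simp add: evenperm_comp evenperm_swap permutation_of_cycle permutation_swap_id)
  then show ?case
    using 1 by (simp del: cycle_of_list.simps)
qed simp_all

text \<open>Fixed points count as cycles, so that the lengths add up to the cardinality of the set.\<close>

inductive cycle_type :: "'a set \<Rightarrow> ('a \<Rightarrow> 'a) \<Rightarrow> nat list \<Rightarrow> bool" where
  empty: "cycle_type {} id []"
| comp: "cycle_type I p Ls \<Longrightarrow> distinct cs \<Longrightarrow> cs \<noteq> [] \<Longrightarrow> set cs \<inter> I = {} \<Longrightarrow>
    cycle_type (set cs \<union> I) (cycle_of_list cs \<circ> p) (length cs # Ls)"

lemma cycle_decomp_imp_cycle_type: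
  assumes "cycle_decomp I p"
  shows "\<exists>Ls. cycle_type I p Ls"
  using assms
proof induction
  case (comp I p cs)
  then obtain Ls where "cycle_type I p Ls"
    by blast
  then show ?case
    \<comment> \<open>\<open>cycle_decomp\<close> also admits empty lists; these act as the identity
      and are dropped, so that all lengths stay positive.\<close>
    using cycle_type.comp[of I p Ls cs] comp.hyps by (cases "cs = []") (auto simp: comp_def)
next
  case empty
  then show ?case
    using cycle_type.empty by (auto simp: id_def)
qed

lemma exists_cycle_type:
  assumes "finite S" and "card S = sum_list Ls" and "0 \<notin> set Ls"
  shows "\<exists>p. cycle_type S p Ls"
  using assms
proof (induction Ls arbitrary: S)
  case Nil
  then show ?case
    using cycle_type.empty by auto
next
  case (Cons l Ls)
  obtain T where T: "T \<subseteq> S" "card T = l" "finite T"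
    using obtain_subset_with_card_n[of l S] Cons.prems by auto
  obtain cs where cs: "set cs = T" "distinct cs"
    using finite_distinct_list[OF T(3)] by blast
  have "card (S - T) = sum_list Ls"
    using T Cons.prems by (simp add: card_Diff_subset)
  then obtain p where "cycle_type (S - T) p Ls"
    using Cons.IH[of "S - T"] Cons.prems by auto
  moreover have "length cs = l"
    using cs T distinct_card by metis
  moreover have "cs \<noteq> []"
    using Cons.prems calculation by auto
  moreover have "set cs \<union> (S - T) = S"
    using cs T by auto
  ultimately show ?case
    using cycle_type.comp[of "S - T" p Ls cs] cs by auto
qed

lemma cycle_type_permutes:
  assumes "cycle_type S p Ls"
  shows "p permutes S" and "finite S"
proof -
  have "p permutes S \<and> finite S"
    using assms
  proof induction
    case (comp I p Ls cs)
    have "cycle_of_list cs permutes (set cs \<union> I)" "p permutes (set cs \<union> I)"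
      using comp by (auto intro: permutes_subset[OF cycle_permutes] permutes_subset)
    from permutes_compose[OF this(2,1)] show ?case
      using comp by (simp add: comp_def)
  qed (simp add: permutes_id flip: id_def)
  then show "p permutes S" "finite S"
    by auto
qed

lemma cycle_type_sum_list: "cycle_type S p Ls \<Longrightarrow> sum_list Ls = card S"
proof (induction rule: cycle_type.induct)
  case (comp I p Ls cs)
  then show ?case
    using cycle_type_permutes(2)[OF comp.hyps(1)] by (simp add: card_Un_disjoint distinct_card)
qed simp

lemma cycle_type_pos: "cycle_type S p Ls \<Longrightarrow> 0 \<notin> set Ls"
  by (induction rule: cycle_type.induct) auto

text \<open>A power is trivial iff it is trivial on each disjoint cycle. The form with an arbitrary
  exponent lets the order be identified by its multiples.\<close>

lemma cycle_type_funpow_eq_id: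
  "cycle_type S p Ls \<Longrightarrow> p ^^ e = id \<longleftrightarrow> Lcm (set Ls) dvd e"
proof (induction rule: cycle_type.induct)
  case (comp I p Ls cs)
  have "(cycle_of_list cs \<circ> p) ^^ e = id \<longleftrightarrow> cycle_of_list cs ^^ e = id \<and> p ^^ e = id"
    by (rule disjoint_permutes_funpow_eq_id[OF cycle_permutes cycle_type_permutes(1)[OF comp.hyps(1)]
          comp.hyps(4)])
  moreover have "p ^^ e = id \<longleftrightarrow> Lcm (set Ls) dvd e"
    using comp.IH by (simp add: id_def)
  ultimately have "(cycle_of_list cs \<circ> p) ^^ e = id \<longleftrightarrow> Lcm (set (length cs # Ls)) dvd e"
    using comp.hyps by (simp add: cycle_of_list_funpow_eq_id)
  then show ?case
    by (simp add: comp_def id_def)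
qed (simp flip: id_def)

lemma cycle_type_evenperm:
  "cycle_type S p Ls \<Longrightarrow> evenperm p \<longleftrightarrow> even (length (filter even Ls))"
proof (induction rule: cycle_type.induct)
  case (comp I p Ls cs)
  have "permutation p"
    using cycle_type_permutes[OF comp.hyps(1)] permutation_permutes by blast
  then have "evenperm (cycle_of_list cs \<circ> p) \<longleftrightarrow> (odd (length cs) \<longleftrightarrow> evenperm p)"
    using comp.hyps by (simp add: evenperm_comp permutation_of_cycle evenperm_cycle_of_list)
  then show ?case
    using comp.IH by (simp add: comp_def)
qed simp

section \<open>Orders of elements of the alternating group\<close>

lemma alt_group_pow: "x [^]\<^bsub>alt_group n\<^esub> (e::nat) = x ^^ e"
proof (induction e)
  case (Suc e)
  then show ?case
    by (simp add: nat_pow_def alt_group_mult funpow_Suc_right del: funpow.simps)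
qed (simp add: nat_pow_def alt_group_one)

lemma ord_alt_group:
  assumes "x \<in> carrier (alt_group n)" and "cycle_type {1..n} x Ls"
  shows "group.ord (alt_group n) x = Lcm (set Ls)"
proof -
  interpret group "alt_group n"
    by (rule alt_group_is_group)
  have "ord x dvd e \<longleftrightarrow> Lcm (set Ls) dvd e" for e
    using pow_eq_id[OF assms(1), of e] cycle_type_funpow_eq_id[OF assms(2), of e]
    by (simp add: alt_group_pow alt_group_one)
  then show ?thesis
    by (meson dvd_antisym dvd_refl)
qed

lemma exists_ord_alt_group:
  assumes "0 \<notin> set Ls" and "even (length (filter even Ls))" and "sum_list Ls \<le> n"
  shows "\<exists>x\<in>carrier (alt_group n). group.ord (alt_group n) x = Lcm (set Ls)"
proof -
  \<comment> \<open>Fixed points fill the lengths up to n; they change neither the lcm nor the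
    number of even lengths.\<close>
  define Ms where "Ms = Ls @ replicate (n - sum_list Ls) 1"
  obtain x where x: "cycle_type {1..n} x Ms"
    using exists_cycle_type[of "{1..n}" Ms] assms by (auto simp: Ms_def sum_list_replicate)
  then have "x \<in> carrier (alt_group n)"
    using cycle_type_permutes(1)[OF x] cycle_type_evenperm[OF x] assms(2)
    by (simp add: alt_group_carrier Ms_def)
  moreover have "Lcm (set Ms) = Lcm (set Ls)"
    by (intro dvd_antisym) (auto simp: Ms_def Lcm_dvd_iff set_replicate_conv_if)
  ultimately show ?thesis
    using ord_alt_group[OF _ x] by auto
qed

text \<open>The order is the lcm of the cycle lengths, so each prime power dividing it divides a
  single length, and the bound on sums of such lengths applies.\<close>

lemma alt_group_degree_ge:
  assumes x: "x \<in> carrier (alt_group n)" and a: "a > 0" "2 ^ a dvd group.ord (alt_group n) x"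
    and Q: "finite Q" "\<And>q. q \<in> Q \<Longrightarrow> prime q \<and> odd q \<and> q dvd group.ord (alt_group n) x"
  shows "2 ^ a + 2 + \<Sum>Q \<le> n"
proof -
  have "cycle_decomp {1..n} x"
    using x by (intro cycle_decomposition) (auto simp: alt_group_carrier)
  then obtain Ls where Ls: "cycle_type {1..n} x Ls"
    using cycle_decomp_imp_cycle_type by blast
  note ord = ord_alt_group[OF x Ls]
  have "2 ^ a + 2 + \<Sum>Q \<le> sum_list Ls"
  proof (rule sum_list_ge_prime_power_divisors)
    show "0 \<notin> set Ls"
      by (rule cycle_type_pos[OF Ls])
    show "even (length (filter even Ls))"
      using x cycle_type_evenperm[OF Ls] by (simp add: alt_group_carrier)
    show "\<exists>l\<in>set Ls. 2 ^ a dvd l"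
      using a ord by (intro prime_power_dvd_Lcm) auto
    show "\<exists>l\<in>set Ls. q dvd l" if "q \<in> Q" for q
      using Q(2)[OF that] ord prime_power_dvd_Lcm[of "set Ls" q 1] by auto
  qed (use a Q in auto)
  also have "\<dots> = n"
    using cycle_type_sum_list[OF Ls] by simp
  finally show ?thesis .
qed

section \<open>Elements of suitable order coprime to p\<close>

text \<open>Otherwise every power of 2 would fit, including one larger than n.\<close>

lemma exists_max_power2_below:
  fixes s n :: nat
  assumes "s + 2 \<le> n"
  shows "\<exists>a>0. s + 2 ^ a \<le> n \<and> n < s + 2 ^ Suc a"
proof (rule ccontr)
  assume contra: "\<not> ?thesis"
  have "s + 2 ^ Suc a \<le> n" for a
  proof (induction a)
    case (Suc a)
    then show ?case
      using contra by (metis not_less zero_less_Suc)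
  qed (use assms in simp)
  from this[of n] show False
    using less_exp[of n] by simp
qed

lemma alt_group_exists_coprime_ord:
  assumes n: "n \<ge> 4" and p: "prime p"
  shows "\<exists>w\<in>carrier (alt_group n). coprime p (group.ord (alt_group n) w) \<and>
    (\<forall>z\<in>carrier (alt_group n). \<not> p * group.ord (alt_group n) w dvd group.ord (alt_group n) z)"
proof (cases "p = 2")
  case True
  obtain P where P: "finite P" "\<And>q. q \<in> P \<Longrightarrow> prime q \<and> p < q"
    "\<Sum>P \<le> n" "n + 2 \<le> \<Sum>P + 2 * p"
    using sum_primes_greedy[of p n] True by auto
  define Ls where "Ls = sorted_list_of_set P"
  have set: "set Ls = P" and sum: "sum_list Ls = \<Sum>P"
    using P(1) by (simp_all add: Ls_def distinct_sum_list_conv_Sum)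
  have odd: "odd q" if "q \<in> P" for q
    using P(2)[OF that] True prime_odd_nat by blast
  have "filter even Ls = []"
    using odd set by (auto simp: filter_empty_conv)
  then obtain w where w: "w \<in> carrier (alt_group n)" "group.ord (alt_group n) w = Lcm P"
    using exists_ord_alt_group[of Ls n] P set sum by fastforce
  have "coprime p (Lcm P)"
  proof (rule prime_imp_coprime[OF p], rule notI)
    assume "p dvd Lcm P"
    then show False
      using prime_power_dvd_Lcm[OF P(1) p, of 1] odd True by auto
  qed
  moreover have "\<not> p * Lcm P dvd group.ord (alt_group n) z" if z: "z \<in> carrier (alt_group n)" for z
  proof
    assume dvd: "p * Lcm P dvd group.ord (alt_group n) z"
    \<comment> \<open>This requires four points beyond the sum of P, whereas the greedy choice
      leaves at most two.\<close>
    have "2 ^ 1 + 2 + \<Sum>P \<le> n"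
    proof (rule alt_group_degree_ge[OF z])
      show "2 ^ 1 dvd group.ord (alt_group n) z"
        using dvd True by (auto intro: dvd_mult_left)
      show "prime q \<and> odd q \<and> q dvd group.ord (alt_group n) z" if "q \<in> P" for q
        using P(2) odd that dvd by (meson dvd_Lcm dvd_mult_right dvd_trans)
    qed (use P in auto)
    then show False
      using P(4) True by simp
  qed
  ultimately show ?thesis
    using w by metis
next
  case False
  then have odd_p: "odd p" "p > 2"
    using p prime_ge_2_nat[OF p] by (auto simp: prime_odd_nat)
  \<comment> \<open>Four points are reserved for two cycles of even length, so that a \<ge> 1 is
    possible below; two such cycles make the permutation even.\<close>
  obtain P where P: "finite P" "\<And>q. q \<in> P \<Longrightarrow> prime q \<and> p < q"
    "\<Sum>P \<le> n - 4" "n - 4 + 2 \<le> \<Sum>P + 2 * p"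
    using sum_primes_greedy[of p "n - 4"] odd_p by auto
  have "\<Sum>P + 2 + 2 \<le> n"
    using P(3) n by linarith
  then obtain a where a: "a > 0" "\<Sum>P + 2 + 2 ^ a \<le> n" "n < \<Sum>P + 2 + 2 ^ Suc a"
    using exists_max_power2_below[of "\<Sum>P + 2" n] by blast
  define Ls where "Ls = 2 ^ a # 2 # sorted_list_of_set P"
  have set: "set Ls = {2 ^ a, 2} \<union> P" and sum: "sum_list Ls = 2 ^ a + 2 + \<Sum>P"
    using P(1) by (simp_all add: Ls_def distinct_sum_list_conv_Sum)
  have odd: "odd q" if "q \<in> P" for q
    using P(2)[OF that] odd_p prime_odd_nat by (meson less_trans)
  have "filter even Ls = [2 ^ a, 2]"
    using odd P(1) a(1) by (auto simp: Ls_def filter_empty_conv)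
  moreover have "0 \<notin> set Ls"
    using P(2) unfolding set by (auto dest: prime_gt_0_nat)
  ultimately obtain w where w: "w \<in> carrier (alt_group n)" "group.ord (alt_group n) w = Lcm (set Ls)"
    using exists_ord_alt_group[of Ls n] a sum by fastforce
  have "coprime p (Lcm (set Ls))"
  proof (rule prime_imp_coprime[OF p], rule notI)
    assume "p dvd Lcm (set Ls)"
    then obtain l where l: "l \<in> set Ls" "p dvd l"
      using prime_power_dvd_Lcm[of "set Ls" p 1] p by auto
    have "\<not> p dvd 2 ^ b" for b
      using p odd_p by (metis dvd_refl nat_neq_iff prime_dvd_power primes_dvd_imp_eq two_is_prime_nat)
    from this[of a] this[of 1] have "l \<in> P"
      using l unfolding set by auto
    then show False
      using P(2) l(2) p by (metis nat_neq_iff primes_dvd_imp_eq)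
  qed
  moreover have "\<not> p * Lcm (set Ls) dvd group.ord (alt_group n) z" if z: "z \<in> carrier (alt_group n)" for z
  proof
    assume dvd: "p * Lcm (set Ls) dvd group.ord (alt_group n) z"
    then have dvd_ord: "l dvd group.ord (alt_group n) z" if "l \<in> set Ls" for l
      using that by (meson dvd_Lcm dvd_mult_right dvd_trans)
    have "2 ^ a + 2 + \<Sum>(insert p P) \<le> n"
    proof (rule alt_group_degree_ge[OF z a(1)])
      show "2 ^ a dvd group.ord (alt_group n) z"
        by (rule dvd_ord) (simp add: set)
      show "prime q \<and> odd q \<and> q dvd group.ord (alt_group n) z" if "q \<in> insert p P" for q
        using that
      proof
        assume "q = p"
        then show ?thesis
          using p odd_p dvd by (auto intro: dvd_mult_left)
      next
        assume "q \<in> P"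
        then show ?thesis
          using P(2) odd dvd_ord[of q] by (simp add: set)
      qed
    qed (use P in auto)
    moreover have "p \<notin> P"
      using P(2) by blast
    \<comment> \<open>Let r = n - 2 - \<Sum>P. The inequality just obtained says 2^a + p \<le> r.
      Greediness gives r \<le> 2p, hence 2^a \<le> p; maximality of a gives r < 2^(a+1), hence p <
      2^a.\<close>
    ultimately show False
      using P a by simp
  qed
  ultimately show ?thesis
    using w by metis
qed

theorem theorem4p8:
  fixes n :: nat
  assumes "n \<ge> 4"
  shows "dominant_vertices (with_proj (order_super_commuting_graph (alt_group n))) = {\<one>\<^bsub>alt_group n\<^esub>}"
proof -
  interpret group "alt_group n"
    by (rule alt_group_is_group)
  let ?G = "alt_group n"
  let ?D = "order_super_commuting_graph ?G"
  have fin: "finite (carrier ?G)"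
  proof (rule finite_subset)
    show "carrier ?G \<subseteq> {p. p permutes {1..n}}"
      by (auto simp: alt_group_carrier)
  qed (simp add: finite_permutations)
  have verts: "pverts ?D = carrier ?G"
    by (simp add: order_super_commuting_graph_def)
  have adj: "(v, w) \<in> parcs ?D \<longleftrightarrow> v \<in> carrier ?G \<and> w \<in> carrier ?G \<and> v \<noteq> w \<and>
      (ord v = ord w \<or> (\<exists>g\<in>carrier ?G. \<exists>h\<in>carrier ?G. ord g = ord v \<and> ord h = ord w \<and>
        g \<noteq> h \<and> g \<otimes>\<^bsub>?G\<^esub> h = h \<otimes>\<^bsub>?G\<^esub> g))" for v w
    by (simp add: order_super_commuting_graph_def)
  show ?thesis
  proof (intro equalityI subsetI)
    fix v
    assume "v \<in> dominant_vertices (with_proj ?D)"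
    then have v: "v \<in> carrier ?G" and dom: "\<And>w. w \<in> carrier ?G \<Longrightarrow> w \<noteq> v \<Longrightarrow> (v, w) \<in> parcs ?D"
      by (auto simp: dominant_vertices_def verts)
    show "v \<in> {\<one>\<^bsub>?G\<^esub>}"
    proof (rule ccontr)
      assume "v \<notin> {\<one>\<^bsub>?G\<^esub>}"
      then have "ord v \<noteq> 1"
        using ord_eq_1[OF v] by simp
      then obtain p where p: "prime p" "p dvd ord v"
        using prime_factor_nat by blast
      obtain w where w: "w \<in> carrier ?G" "coprime p (ord w)"
        and no_ord: "\<And>z. z \<in> carrier ?G \<Longrightarrow> \<not> p * ord w dvd ord z"
        using alt_group_exists_coprime_ord[OF assms p(1)] by metis
      \<comment> \<open>p divides one order and is coprime to the other, so adjacency can only come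
        from commuting representatives.\<close>
      have ord_neq: "ord v \<noteq> ord w"
        using p w(2) by (metis coprime_absorb_left not_prime_unit)
      then have "(v, w) \<in> parcs ?D"
        using dom[OF w(1)] by blast
      then obtain g h where gh: "g \<in> carrier ?G" "h \<in> carrier ?G" "ord g = ord v" "ord h = ord w"
        "g \<otimes>\<^bsub>?G\<^esub> h = h \<otimes>\<^bsub>?G\<^esub> g"
        using ord_neq unfolding adj by blast
      have "ord g > 0"
        using ord_ge_1[OF fin gh(1)] by simp
      then show False
        using exists_ord_dvd_of_commuting[OF gh(1) _ gh(2,5), of p] p w no_ord gh by metis
    qed
  next
    fix v
    assume "v \<in> {\<one>\<^bsub>?G\<^esub>}"
    then have v: "v = \<one>\<^bsub>?G\<^esub>"
      by simp
    have "(v, w) \<in> parcs ?D" if "w \<in> carrier ?G" "w \<noteq> v" for w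
    proof -
      \<comment> \<open>The identity and w themselves serve as the distinct commuting
        representatives.\<close>
      have "\<one>\<^bsub>?G\<^esub> \<otimes>\<^bsub>?G\<^esub> w = w \<otimes>\<^bsub>?G\<^esub> \<one>\<^bsub>?G\<^esub>"
        using that(1) by simp
      then show ?thesis
        unfolding adj using that v one_closed by metis
    qed
    then show "v \<in> dominant_vertices (with_proj ?D)"
      by (auto simp: dominant_vertices_def verts v)
  qed
qed

end
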